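(* Every odd prime $p\in J$ is exceptional.
   Context: For odd $m\ge 3$ let $\mathbb{Z}_m=\mathbb{Z}/m\mathbb{Z}$. A Cayley subset of $\mathbb{Z}_m$ is a subset $S$ with $0\notin S$, $S=-S$, generating $\mathbb{Z}_m$. $X(S)$ is the Cayley graph on $\mathbb{Z}_m$ ($x\sim y$ iff $y-x\in S$), with non-trivial eigenvalues $\mu_j(S)=\sum_{a\in S}e^{2\pi i a j/m}$ ($1\le j\le m-1$) and $\mu(S)=\max_j|\mu_j(S)|$; it is Ramanujan if $\mu(S)\le 2\sqrt{|S|-1}$. The covalency is $l(S)=m-|S|$. $\hat{l}$ is the largest covalency value $l$ such that $X(S)$ is Ramanujan for every Cayley subset $S$ with $l(S)\le l$. Let $l_0=2\lfloor\sqrt{m}-\frac32\rfloor+1$; $m\ge 15$ is called exceptional if $\hat{l}=l_0+2$. $J=\{2n+1: 7\le n\le 14\}\cup\{k^2+5k+c: k\ge 4,\ c\in\{\pm1,\pm3,5\}\}\cup\{k^2+5k-5: k\ge 19\}$ (all elements of $J$ are $\ge 15$). *)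

theory Defs
  imports Complex_Main "HOL-Computational_Algebra.Primes" "HOL-Algebra.Elementary_Groups"
begin

definition cayley_subset :: "nat \<Rightarrow> int set \<Rightarrow> bool" where
  "cayley_subset m S \<longleftrightarrow>
     S \<subseteq> carrier (integer_mod_group m) \<and>
     \<one>\<^bsub>integer_mod_group m\<^esub> \<notin> S \<and>
     S = set_inv\<^bsub>integer_mod_group m\<^esub> S \<and>
     generate (integer_mod_group m) S = carrier (integer_mod_group m)"

definition cayley_adj :: "nat \<Rightarrow> int set \<Rightarrow> int \<Rightarrow> int \<Rightarrow> bool" where
  "cayley_adj m S x y \<longleftrightarrow> y \<otimes>\<^bsub>integer_mod_group m\<^esub> inv\<^bsub>integer_mod_group m\<^esub> x \<in> S"

definition eigval :: "nat \<Rightarrow> int set \<Rightarrow> nat \<Rightarrow> complex" where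
  "eigval m S j = (\<Sum>a\<in>S. exp (2 * of_real pi * \<i> * of_int a * of_nat j / of_nat m))"

definition max_eigval :: "nat \<Rightarrow> int set \<Rightarrow> real" where
  "max_eigval m S = Max ((\<lambda>j. cmod (eigval m S j)) ` {1..m - 1})"

definition ramanujan :: "nat \<Rightarrow> int set \<Rightarrow> bool" where
  "ramanujan m S \<longleftrightarrow> max_eigval m S \<le> 2 * sqrt (real (card S) - 1)"

definition covalency :: "nat \<Rightarrow> int set \<Rightarrow> nat" where
  "covalency m S = m - card S"

definition good_covalencies :: "nat \<Rightarrow> nat set" where
  "good_covalencies m =
     {l \<in> covalency m ` {S. cayley_subset m S}.
        \<forall>S. cayley_subset m S \<and> covalency m S \<le> l \<longrightarrow> ramanujan m S}"

definition l_hat :: "nat \<Rightarrow> nat" where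
  "l_hat m = Max (good_covalencies m)"

definition l_zero :: "nat \<Rightarrow> int" where
  "l_zero m = 2 * \<lfloor>sqrt (real m) - 3 / 2\<rfloor> + 1"

definition exceptional :: "nat \<Rightarrow> bool" where
  "exceptional m \<longleftrightarrow> odd m \<and> m \<ge> 15 \<and> int (l_hat m) = l_zero m + 2"

definition J :: "nat set" where
  "J = {2 * n + 1 | n. 7 \<le> n \<and> n \<le> 14}
     \<union> {m. \<exists>(k::nat) (c::int). k \<ge> 4 \<and> c \<in> {1, -1, 3, -3, 5} \<and> int m = int k ^ 2 + 5 * int k + c}
     \<union> {m. \<exists>k::nat. k \<ge> 19 \<and> int m = int k ^ 2 + 5 * int k - 5}"

text \<open>The characters of the group are eigenvectors of the adjacency operator of the Cayley graph,
  with eigenvalues \<^const>\<open>eigval\<close>; the index \<open>j = 0\<close> is the trivial one.\<close>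

lemma exp_char_mod:
  assumes "m > 0"
  shows "exp (2 * of_real pi * \<i> * of_int (a mod int m) * of_nat j / of_nat m)
       = exp (2 * of_real pi * \<i> * of_int a * of_nat j / of_nat m)"
proof -
  have "a = a mod int m + int m * (a div int m)" by simp
  then have "(of_int a :: complex) = of_int (a mod int m) + of_nat m * of_int (a div int m)"
    by (metis of_int_add of_int_mult of_int_of_nat_eq)
  then have "2 * of_real pi * \<i> * of_int a * of_nat j / of_nat m
      = 2 * of_real pi * \<i> * of_int (a mod int m) * of_nat j / of_nat m
        + 2 * of_real pi * \<i> * of_int (a div int m * int j)"
    using assms by (simp add: field_simps)
  moreover have "exp (2 * of_real pi * \<i> * of_int k) = 1" for k
    using cis_multiple_2pi[of "of_int k"] by (simp add: cis_conv_exp mult_ac)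
  ultimately show ?thesis by (simp only: exp_add mult_1_right)
qed

lemma cayley_adj_eigenvector:
  fixes m j :: nat
  assumes m: "m > 0" and S: "S \<subseteq> carrier (integer_mod_group m)"
    and x: "x \<in> carrier (integer_mod_group m)"
  defines "\<chi> \<equiv> \<lambda>y::int. exp (2 * of_real pi * \<i> * of_int y * of_nat j / of_nat m)"
  shows "(\<Sum>y | y \<in> carrier (integer_mod_group m) \<and> cayley_adj m S x y. \<chi> y) = eigval m S j * \<chi> x"
proof -
  have C: "carrier (integer_mod_group m) = {0..<int m}"
    using m by (simp add: carrier_integer_mod_group)
  have adj: "cayley_adj m S x y \<longleftrightarrow> (y - x) mod int m \<in> S" for y
    using x by (simp add: cayley_adj_def mod_add_right_eq)
  have add: "\<chi> ((a + x) mod int m) = \<chi> a * \<chi> x" for a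
    unfolding \<chi>_def exp_char_mod[OF m] exp_add[symmetric]
    by (simp add: field_simps add_divide_distrib)
  have "(\<Sum>y | y \<in> carrier (integer_mod_group m) \<and> cayley_adj m S x y. \<chi> y)
      = (\<Sum>a\<in>S. \<chi> ((a + x) mod int m))"
  proof (rule sum.reindex_bij_witness[of _ "\<lambda>a. (a + x) mod int m" "\<lambda>y. (y - x) mod int m"])
    fix a assume "a \<in> S"
    then have a: "a \<in> {0..<int m}" using S C by auto
    show "((a + x) mod int m - x) mod int m = a"
      using a by (simp add: mod_diff_left_eq)
    then show "(a + x) mod int m \<in> {y \<in> carrier (integer_mod_group m). cayley_adj m S x y}"
      using m \<open>a \<in> S\<close> by (simp add: C adj)
  qed (use m in \<open>auto simp: adj C mod_add_left_eq\<close>)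
  also have "\<dots> = (\<Sum>a\<in>S. \<chi> a) * \<chi> x"
    by (simp only: add sum_distrib_right)
  also have "(\<Sum>a\<in>S. \<chi> a) = eigval m S j"
    by (simp only: eigval_def \<chi>_def)
  finally show ?thesis .
qed

text \<open>The set whose maximum defines \<^const>\<open>l_hat\<close> is finite and contains \<open>1\<close>, the covalency of the
  complete graph.\<close>

lemma finite_good_covalencies: "finite (good_covalencies m)"
  by (rule finite_subset[of _ "{..m}"]) (auto simp: good_covalencies_def covalency_def)

lemma one_in_good_covalencies:
  assumes m: "m \<ge> 3"
  shows "1 \<in> good_covalencies m"
proof -
  let ?G = "integer_mod_group m"
  let ?S = "{1..<int m}"
  have C: "carrier ?G = {0..<int m}"
    using m by (simp add: carrier_integer_mod_group)
  have inv: "inv\<^bsub>?G\<^esub> a = int m - a" if "a \<in> ?S" for a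
    using that by (simp add: C zmod_zminus1_eq_if)
  have "?S = (\<lambda>a. int m - a) ` ?S"
  proof (intro equalityI subsetI)
    fix x assume "x \<in> ?S"
    then show "x \<in> (\<lambda>a. int m - a) ` ?S" by (intro image_eqI[of _ _ "int m - x"]) auto
  qed auto
  also have "\<dots> = set_inv\<^bsub>?G\<^esub> ?S"
    unfolding SET_INV_def UNION_singleton_eq_range by (rule image_cong) (simp_all only: inv)
  finally have sym: "?S = set_inv\<^bsub>?G\<^esub> ?S" .
  have "generate ?G ?S = carrier ?G"
  proof
    show "generate ?G ?S \<subseteq> carrier ?G"
      by (rule group.generate_incl) (auto simp: C)
    show "carrier ?G \<subseteq> generate ?G ?S"
    proof
      fix x assume "x \<in> carrier ?G"
      then consider "x = \<one>\<^bsub>?G\<^esub>" | "x \<in> ?S" by (force simp: C)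
      then show "x \<in> generate ?G ?S" by cases (blast intro: generate.intros)+
    qed
  qed
  then have cay: "cayley_subset m ?S"
    using sym by (auto simp: cayley_subset_def C)
  have cov: "covalency m ?S = 1"
    using m by (simp add: covalency_def)
  have uniq: "S = ?S" if "cayley_subset m S" "covalency m S \<le> 1" for S
  proof -
    have sub: "S \<subseteq> ?S"
    proof
      fix x assume "x \<in> S"
      then have "x \<in> {0..<int m}" "x \<noteq> 0"
        using that(1) by (auto simp: cayley_subset_def C)
      then show "x \<in> ?S" by auto
    qed
    moreover have "card ?S \<le> card S"
      using that(2) m by (simp add: covalency_def)
    ultimately show ?thesis
      by (meson card_seteq finite_atLeastLessThan_int)
  qed
  have eig: "eigval m ?S j = -1" if j: "j \<in> {1..m - 1}" for j
  proof -
    define z where "z = exp (2 * of_real pi * \<i> * of_nat j / of_nat m)"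
    have pw: "exp (2 * of_real pi * \<i> * of_int (int k) * of_nat j / of_nat m) = z ^ k" for k
      unfolding z_def exp_of_nat_mult[symmetric] by (simp add: field_simps)
    have "z ^ m = 1"
      using exp_char_mod[of m "int m" j] m unfolding pw by simp
    moreover have "z \<noteq> 1"
    proof
      assume "z = 1"
      then have "cis (2 * pi * (real j / real m)) = 1"
        unfolding z_def cis_conv_exp by (simp add: mult_ac)
      then have "cos (2 * pi * (real j / real m)) = 1"
        by (simp add: complex_eq_iff)
      then obtain k :: int where "2 * pi * (real j / real m) = of_int k * 2 * pi"
        using cos_one_2pi_int by auto
      then have "real j / real m = of_int k"
        using m by (simp add: field_simps)
      moreover have "0 < real j / real m" "real j / real m < 1"
        using j m by (auto simp: field_simps)
      ultimately have "0 < k" "k < 1" by simp_all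
      then show False by simp
    qed
    ultimately have "(\<Sum>k<m. z ^ k) = 0"
      by (simp add: geometric_sum)
    moreover have "{..<m} = insert 0 {1..<m}" using m by auto
    ultimately have "(\<Sum>k\<in>{1..<m}. z ^ k) = -1"
      by (simp add: eq_neg_iff_add_eq_0 add.commute)
    moreover have "eigval m ?S j = (\<Sum>k\<in>{1..<m}. z ^ k)"
      unfolding eigval_def
    proof (rule sum.reindex_bij_witness[of _ int nat])
      fix a assume "a \<in> ?S"
      then have "int (nat a) = a" by simp
      then show "z ^ nat a = exp (2 * of_real pi * \<i> * of_int a * of_nat j / of_nat m)"
        using pw[of "nat a"] by (simp only:)
    qed auto
    ultimately show ?thesis by simp
  qed
  have "max_eigval m ?S = Max ((\<lambda>_. 1) ` {1..m - 1})"
    unfolding max_eigval_def by (intro arg_cong[where f = Max] image_cong) (auto simp: eig)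
  also have "\<dots> = 1"
    using image_constant[of "1::nat" "{1..m - 1}" "1::real"] m by simp
  also have "1 \<le> 2 * sqrt (real (card ?S) - 1)"
  proof -
    have "1 \<le> sqrt (real (card ?S) - 1)" using m by auto
    then show ?thesis by linarith
  qed
  finally have "ramanujan m ?S" unfolding ramanujan_def .
  then have "\<forall>S. cayley_subset m S \<and> covalency m S \<le> 1 \<longrightarrow> ramanujan m S"
    using uniq by blast
  moreover have "1 \<in> covalency m ` {S. cayley_subset m S}"
    using cay cov by (metis imageI mem_Collect_eq)
  ultimately show ?thesis
    unfolding good_covalencies_def by blast
qed

end

theory Submission
  imports Defs "HOL-Analysis.Complex_Transcendental" "HOL-Number_Theory.Cong"
begin

text \<open>For \<open>j \<noteq> 0\<close> the eigenvalue of \<open>S\<close> is minus the character sum over the complement \<open>T\<close> of \<open>S\<close>, which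
  contains \<open>0\<close> and has \<open>l(S)\<close> elements. As \<open>p\<close> is prime, multiplication by \<open>j\<close> permutes the residues; so
  among the sets of \<open>l = 2r + 1\<close> residues the sum is largest for \<open>{-r, \<dots>, r}\<close>, where it is the Dirichlet
  kernel \<open>D l = sin (l\<pi>/p) / sin (\<pi>/p)\<close>, and it is at least \<open>2 - l\<close>. Covalencies being odd, the largest
  good one is the odd \<open>l\<close> with \<open>(D l)\<^sup>2 \<le> 4(p - l - 1)\<close> and \<open>(D (l + 2))\<^sup>2 > 4(p - l - 3)\<close>. For
  \<open>p = k\<^sup>2 + 5k + c\<close> one has \<open>l\<^sub>0 = 2k + 1\<close>. With \<open>l = 2k + 3\<close> and \<open>d = 25 - 4c\<close>, the bound \<open>4(p - l - 1)\<close>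
  is \<open>l\<^sup>2 - d\<close>, whereas \<open>(D l)\<^sup>2\<close> is about \<open>l\<^sup>2 - 16\<pi>\<^sup>2/3\<close>, where \<open>16\<pi>\<^sup>2/3 > 52\<close>; so \<open>c \<ge> -5\<close>, that is
  \<open>d \<le> 45\<close>, makes \<open>l\<close> good for large \<open>k\<close>. From \<open>l\<close> to \<open>l + 2\<close> the bound drops by \<open>8\<close> while the square of
  the kernel grows by about \<open>4l\<close>. The primes \<open>17, 19, 23, 29\<close> have the same form with \<open>k = 2, 2, 3, 3\<close> and
  \<open>c = 3, 5, -1, 5\<close>.\<close>

section \<open>Trigonometric estimates\<close>

lemma pi_square_bounds: "9.8688 \<le> pi\<^sup>2" "pi\<^sup>2 \<le> 9.87"
proof -
  have "3.14149\<^sup>2 \<le> pi\<^sup>2" "pi\<^sup>2 \<le> 3.1416\<^sup>2"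
    using pi_approx by (auto intro!: power_mono)
  then show "9.8688 \<le> pi\<^sup>2" "pi\<^sup>2 \<le> 9.87" by (auto simp: power2_eq_square)
qed

lemma sin_pi_div_pos: "1 < m \<Longrightarrow> 0 < sin (pi / m)" for m :: real
  by (intro sin_gt_zero) (auto simp: field_simps)

lemma cos_le_quartic: "cos x \<le> 1 - x\<^sup>2 / 2 + x ^ 4 / 24" for x :: real
proof -
  obtain t where "cos x = (\<Sum>i<4. cos_coeff i * x ^ i) + cos (t + 1/2 * real 4 * pi) / fact 4 * x ^ 4"
    using Maclaurin_cos_expansion[of x 4] by blast
  moreover have "cos (t + 1/2 * real 4 * pi) * x ^ 4 \<le> 1 * x ^ 4"
    by (intro mult_right_mono) auto
  ultimately show ?thesis
    by (simp add: cos_coeff_def lessThan_nat_numeral fact_numeral)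
qed

lemma cos_ge_sextic: "1 - x\<^sup>2 / 2 + x ^ 4 / 24 - x ^ 6 / 720 \<le> cos x" for x :: real
proof -
  obtain t where "cos x = (\<Sum>i<6. cos_coeff i * x ^ i) + cos (t + 1/2 * real 6 * pi) / fact 6 * x ^ 6"
    using Maclaurin_cos_expansion[of x 6] by blast
  moreover have "- 1 * x ^ 6 \<le> cos (t + 1/2 * real 6 * pi) * x ^ 6"
    by (intro mult_right_mono) auto
  ultimately show ?thesis
    by (simp add: cos_coeff_def lessThan_nat_numeral fact_numeral)
qed

lemma sin_square_ge: "x\<^sup>2 - x ^ 4 / 3 \<le> (sin x)\<^sup>2" for x :: real
  using cos_le_quartic[of "2 * x"] by (simp add: cos_double_sin power_mult_distrib)

lemma sin_square_le_sextic: "(sin x)\<^sup>2 \<le> x\<^sup>2 - x ^ 4 / 3 + 2 * x ^ 6 / 45" for x :: real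
  using cos_ge_sextic[of "2 * x"] by (simp add: cos_double_sin power_mult_distrib)

lemma sin_square_le: "(sin x)\<^sup>2 \<le> x\<^sup>2" for x :: real
  using abs_sin_x_le_abs_x[of x] by (simp add: abs_le_square_iff)

section \<open>The Dirichlet kernel\<close>

definition dirichlet_kernel :: "real \<Rightarrow> real \<Rightarrow> real" where
  "dirichlet_kernel l x = sin (l * x) / sin x"

lemma sum_cos_mult_sin:
  "(\<Sum>a = - int r..int r. cos (2 * of_int a * x)) * sin x = sin (real (2 * r + 1) * x)"
proof (induction r)
  case 0
  then show ?case by simp
next
  case (Suc r)
  let ?y = "2 * (real r + 1) * x"
  have "{- int (Suc r)..int (Suc r)} = insert (- int r - 1) (insert (int r + 1) {- int r..int r})"
    by auto
  then have "(\<Sum>a = - int (Suc r)..int (Suc r). cos (2 * of_int a * x))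
      = cos (2 * of_int (- int r - 1) * x) + (cos (2 * of_int (int r + 1) * x)
        + (\<Sum>a = - int r..int r. cos (2 * of_int a * x)))"
    by simp
  moreover have "2 * of_int (- int r - 1) * x = - ?y" "2 * of_int (int r + 1) * x = ?y"
    by (simp_all add: algebra_simps)
  ultimately have "(\<Sum>a = - int (Suc r)..int (Suc r). cos (2 * of_int a * x))
      = 2 * cos ?y + (\<Sum>a = - int r..int r. cos (2 * of_int a * x))"
    by (simp only: cos_minus)
  then have "(\<Sum>a = - int (Suc r)..int (Suc r). cos (2 * of_int a * x)) * sin x
      = 2 * cos ?y * sin x + sin (real (2 * r + 1) * x)"
    by (simp add: distrib_right Suc.IH)
  also have "2 * cos ?y * sin x = sin (?y + x) - sin (?y - x)"
    by (simp add: mult.assoc cos_times_sin)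
  finally show ?case by (simp add: algebra_simps)
qed

lemma sum_cos_eq_dirichlet_kernel:
  "sin x \<noteq> 0 \<Longrightarrow> (\<Sum>a = - int r..int r. cos (2 * of_int a * x)) = dirichlet_kernel (real (2 * r + 1)) x"
  using sum_cos_mult_sin[of x r] by (simp add: dirichlet_kernel_def field_simps)

lemma dirichlet_kernel_square_le:
  assumes d: "0 \<le> d" "d \<le> l\<^sup>2" "d \<le> x\<^sup>2 * l\<^sup>2 * (l\<^sup>2 - 1) / 3 - 2 * x ^ 4 * l ^ 6 / 45"
  shows "(dirichlet_kernel l x)\<^sup>2 \<le> l\<^sup>2 - d"
proof -
  have "0 \<le> d * x\<^sup>2 / 3" using d(1) by simp
  then have "l\<^sup>2 - x\<^sup>2 * l ^ 4 / 3 + 2 * x ^ 4 * l ^ 6 / 45 \<le> (l\<^sup>2 - d) * (1 - x\<^sup>2 / 3)"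
    using d(3) by (simp add: field_simps eval_nat_numeral)
  then have "x\<^sup>2 * (l\<^sup>2 - x\<^sup>2 * l ^ 4 / 3 + 2 * x ^ 4 * l ^ 6 / 45)
      \<le> x\<^sup>2 * ((l\<^sup>2 - d) * (1 - x\<^sup>2 / 3))"
    by (intro mult_left_mono) auto
  moreover have "x\<^sup>2 * (l\<^sup>2 - x\<^sup>2 * l ^ 4 / 3 + 2 * x ^ 4 * l ^ 6 / 45)
      = (l * x)\<^sup>2 - (l * x) ^ 4 / 3 + 2 * (l * x) ^ 6 / 45"
    by (simp add: field_simps eval_nat_numeral)
  moreover have "x\<^sup>2 * ((l\<^sup>2 - d) * (1 - x\<^sup>2 / 3)) = (l\<^sup>2 - d) * (x\<^sup>2 - x ^ 4 / 3)"
    by (simp add: field_simps eval_nat_numeral)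
  ultimately have "(sin (l * x))\<^sup>2 \<le> (l\<^sup>2 - d) * (x\<^sup>2 - x ^ 4 / 3)"
    using sin_square_le_sextic[of "l * x"] by linarith
  also have "\<dots> \<le> (l\<^sup>2 - d) * (sin x)\<^sup>2"
    using d(2) by (intro mult_left_mono sin_square_ge) auto
  finally have "(sin (l * x))\<^sup>2 \<le> (l\<^sup>2 - d) * (sin x)\<^sup>2" .
  then show ?thesis
    using d(2) by (cases "sin x = 0") (simp_all add: dirichlet_kernel_def power_divide pos_divide_le_eq)
qed

lemma dirichlet_kernel_square_gt:
  assumes "sin x \<noteq> 0" "0 \<le> R" "R < l\<^sup>2 - x\<^sup>2 * l ^ 4 / 3"
  shows "R < (dirichlet_kernel l x)\<^sup>2"
proof -
  have "x \<noteq> 0" using assms(1) by auto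
  have "R * (sin x)\<^sup>2 \<le> R * x\<^sup>2"
    using assms(2) by (intro mult_left_mono sin_square_le)
  also have "\<dots> < (l\<^sup>2 - x\<^sup>2 * l ^ 4 / 3) * x\<^sup>2"
    using assms(3) \<open>x \<noteq> 0\<close> by simp
  also have "\<dots> = (l * x)\<^sup>2 - (l * x) ^ 4 / 3"
    by (simp add: field_simps eval_nat_numeral)
  also have "\<dots> \<le> (sin (l * x))\<^sup>2"
    by (rule sin_square_ge)
  finally show ?thesis
    using assms(1) by (simp add: dirichlet_kernel_def power_divide pos_less_divide_eq)
qed

lemma dirichlet_kernel_square_gt_near_pi_half:
  assumes "sin x \<noteq> 0" "0 \<le> R" "R * x\<^sup>2 + (pi / 2 - l * x)\<^sup>2 < 1"
  shows "R < (dirichlet_kernel l x)\<^sup>2"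
proof -
  have "R * (sin x)\<^sup>2 \<le> R * x\<^sup>2"
    using assms(2) by (intro mult_left_mono sin_square_le)
  also have "\<dots> < 1 - (pi / 2 - l * x)\<^sup>2"
    using assms(3) by simp
  also have "\<dots> \<le> 1 - (sin (pi / 2 - l * x))\<^sup>2"
    using sin_square_le by simp
  also have "\<dots> = (sin (l * x))\<^sup>2"
    by (simp add: cos_squared_eq sin_diff flip: sin_cos_eq)
  finally show ?thesis
    using assms(1) by (simp add: dirichlet_kernel_def power_divide pos_less_divide_eq)
qed

section \<open>Character sums\<close>

lemma char_eq_cis:
  "exp (2 * of_real pi * \<i> * of_int a * of_nat j / of_nat m) = cis (2 * of_int a * (pi * real j / real m))"
  by (simp add: cis_conv_exp mult_ac)

lemma Re_eigval: "Re (eigval m S j) = (\<Sum>a\<in>S. cos (2 * of_int a * (pi * real j / real m)))"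
  by (simp add: eigval_def char_eq_cis)

lemma Im_eigval: "Im (eigval m S j) = (\<Sum>a\<in>S. sin (2 * of_int a * (pi * real j / real m)))"
  by (simp add: eigval_def char_eq_cis)

lemma
  assumes "m > 0" "[a = b] (mod int m)"
  shows cos_char_cong: "cos (2 * of_int a * (pi * real j / real m)) = cos (2 * of_int b * (pi * real j / real m))"
    and sin_char_cong: "sin (2 * of_int a * (pi * real j / real m)) = sin (2 * of_int b * (pi * real j / real m))"
proof -
  have "cis (2 * of_int a * (pi * real j / real m)) = cis (2 * of_int b * (pi * real j / real m))"
    using exp_char_mod[OF assms(1), of a j] exp_char_mod[OF assms(1), of b j] assms(2)
    unfolding char_eq_cis cong_def by metis
  then show "cos (2 * of_int a * (pi * real j / real m)) = cos (2 * of_int b * (pi * real j / real m))"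
    "sin (2 * of_int a * (pi * real j / real m)) = sin (2 * of_int b * (pi * real j / real m))"
    by (simp_all add: complex_eq_iff)
qed

lemma eigval_of_real_if_symmetric:
  assumes m: "m > 0" and S: "\<And>a. a \<in> S \<Longrightarrow> int m - a \<in> S"
  shows "eigval m S j = of_real (Re (eigval m S j))"
proof -
  let ?s = "\<lambda>a. sin (2 * of_int a * (pi * real j / real m))"
  have reflect: "?s (int m - a) = - ?s a" for a
    using sin_char_cong[OF m, of "int m - a" "- a" j] by (simp add: cong_iff_dvd_diff)
  have "(\<Sum>a\<in>S. ?s a) = (\<Sum>a\<in>S. ?s (int m - a))"
    by (rule sum.reindex_bij_witness[of _ "\<lambda>a. int m - a" "\<lambda>a. int m - a"]) (auto simp: S)
  also have "\<dots> = - (\<Sum>a\<in>S. ?s a)"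
    by (simp only: reflect sum_negf)
  finally show ?thesis by (simp add: complex_eq_iff Im_eigval)
qed

lemma eigval_period:
  assumes "m > 0" "\<not> m dvd j"
  shows "eigval m {b..<b + int m} j = 0"
proof -
  define z where "z = exp (2 * of_real pi * \<i> * of_nat j / of_nat m)"
  have z: "z \<noteq> 1" "z ^ m = 1"
    using complex_root_unity_eq_1[of m j] complex_root_unity[of m j] assms by (auto simp: z_def)
  have char: "exp (2 * of_real pi * \<i> * of_int (b + int i) * of_nat j / of_nat m)
      = exp (2 * of_real pi * \<i> * of_int b * of_nat j / of_nat m) * z ^ i" for i
    unfolding z_def exp_of_nat_mult[symmetric] exp_add[symmetric]
    by (simp add: field_simps add_divide_distrib)
  have "eigval m {b..<b + int m} j
      = (\<Sum>i<m. exp (2 * of_real pi * \<i> * of_int (b + int i) * of_nat j / of_nat m))"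
    unfolding eigval_def
    by (rule sum.reindex_bij_witness[of _ "\<lambda>i. b + int i" "\<lambda>a. nat (a - b)"]) auto
  also have "\<dots> = exp (2 * of_real pi * \<i> * of_int b * of_nat j / of_nat m) * (\<Sum>i<m. z ^ i)"
    by (simp only: char sum_distrib_left)
  also have "(\<Sum>i<m. z ^ i) = 0"
    using z by (simp add: geometric_sum)
  finally show ?thesis by simp
qed

lemma eigval_eq_uminus_Compl:
  assumes "m > 0" "\<not> m dvd j" "S \<subseteq> {b..<b + int m}"
  shows "eigval m S j = - eigval m ({b..<b + int m} - S) j"
proof -
  have "eigval m {b..<b + int m} j = eigval m ({b..<b + int m} - S) j + eigval m S j"
    unfolding eigval_def using assms(3) by (rule sum.subset_diff) simp
  then show ?thesis
    by (simp add: eigval_period[OF assms(1,2)] eq_neg_iff_add_eq_0 add.commute)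
qed

lemma Re_eigval_ge:
  assumes "finite T" "0 \<in> T"
  shows "2 - real (card T) \<le> Re (eigval m T j)"
proof -
  let ?c = "\<lambda>a. cos (2 * of_int a * (pi * real j / real m))"
  have "(\<Sum>a\<in>T - {0}. - 1) \<le> (\<Sum>a\<in>T - {0}. ?c a)"
    by (intro sum_mono) simp
  moreover have "Re (eigval m T j) = 1 + (\<Sum>a\<in>T - {0}. ?c a)"
    unfolding Re_eigval by (subst sum.remove[OF assms]) simp
  moreover have "card T \<ge> 1" using assms by (auto simp: Suc_le_eq card_gt_0_iff)
  ultimately show ?thesis using assms by (simp add: of_nat_diff)
qed

lemma sum_le_sum_superlevel_set:
  fixes f :: "'a \<Rightarrow> 'b :: linordered_idom"
  assumes fin: "finite U" "finite C" and card: "card U \<le> card C" and level: "0 \<le> t"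
    and inside: "\<And>a. a \<in> C \<Longrightarrow> t \<le> f a" and outside: "\<And>a. a \<in> U - C \<Longrightarrow> f a \<le> t"
  shows "sum f U \<le> sum f C"
proof -
  have "(\<Sum>a\<in>U. f a - t) = (\<Sum>a\<in>U \<inter> C. f a - t) + (\<Sum>a\<in>U - C. f a - t)"
    using fin(1) by (rule sum.Int_Diff)
  also have "\<dots> \<le> (\<Sum>a\<in>U \<inter> C. f a - t)"
    using outside by (auto intro: sum_nonpos)
  also have "\<dots> \<le> (\<Sum>a\<in>C. f a - t)"
    using fin inside by (intro sum_mono2) auto
  finally have "sum f U - of_nat (card U) * t \<le> sum f C - of_nat (card C) * t"
    by (simp add: sum_subtractf)
  moreover have "of_nat (card U) * t \<le> of_nat (card C) * t"
    using card level by (intro mult_right_mono) auto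
  ultimately show ?thesis by linarith
qed

definition centered_residue :: "nat \<Rightarrow> int \<Rightarrow> int" where
  "centered_residue m a = (a + int m div 2) mod int m - int m div 2"

lemma abs_centered_residue_le:
  assumes "m > 0"
  shows "2 * \<bar>centered_residue m a\<bar> \<le> int m"
proof -
  have "2 * \<bar>x - int m div 2\<bar> \<le> int m" if "0 \<le> x" "x < int m" for x
    using that by presburger
  then show ?thesis using assms by (simp add: centered_residue_def)
qed

lemma cong_centered_residue: "[centered_residue m a = a] (mod int m)"
  by (simp add: centered_residue_def cong_def mod_diff_left_eq)

lemma inj_on_centered_residue_mult:
  assumes "coprime j m"
  shows "inj_on (\<lambda>a. centered_residue m (a * int j)) {0..<int m}"
proof (rule inj_onI)
  fix a b assume ab: "a \<in> {0..<int m}" "b \<in> {0..<int m}"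
    and eq: "centered_residue m (a * int j) = centered_residue m (b * int j)"
  have "[a * int j = b * int j] (mod int m)"
    using cong_centered_residue[of m "a * int j"] cong_centered_residue[of m "b * int j"]
    unfolding eq by (blast intro: cong_trans cong_sym)
  then have "[a = b] (mod int m)" using assms by (simp add: cong_mult_rcancel)
  then show "a = b" using ab by (auto intro: cong_less_imp_eq_int)
qed

lemma sum_cos_centered_le:
  fixes m r :: nat and U :: "int set"
  assumes m: "m > 0" and U: "finite U" "\<And>a. a \<in> U \<Longrightarrow> 2 * \<bar>a\<bar> \<le> int m" "card U \<le> 2 * r + 1"
    and r: "4 * r \<le> m"
  shows "(\<Sum>a\<in>U. cos (2 * of_int a * (pi / m))) \<le> (\<Sum>a = - int r..int r. cos (2 * of_int a * (pi / m)))"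
proof (rule sum_le_sum_superlevel_set)
  let ?c = "\<lambda>a :: int. cos (2 * of_int a * (pi / m))"
  have antimono: "?c b \<le> ?c a" if "\<bar>a\<bar> \<le> \<bar>b\<bar>" "2 * \<bar>b\<bar> \<le> int m" for a b
  proof -
    have "real_of_int (2 * \<bar>b\<bar>) \<le> real_of_int (int m)" using that(2) by (simp only: of_int_le_iff)
    then have "cos (2 * of_int \<bar>b\<bar> * (pi / m)) \<le> cos (2 * of_int \<bar>a\<bar> * (pi / m))"
      using that(1) m by (intro cos_monotone_0_pi_le) (auto simp: field_simps)
    then show ?thesis by (simp add: abs_if split: if_splits)
  qed
  show "?c (int r) \<le> ?c a" if "a \<in> {- int r..int r}" for a
    using that r by (intro antimono) auto
  show "?c a \<le> ?c (int r)" if "a \<in> U - {- int r..int r}" for a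
    using that U(2) by (intro antimono) auto
  show "0 \<le> ?c (int r)"
  proof (rule cos_ge_zero)
    have "4 * real r \<le> real m" using r by linarith
    then show "2 * of_int (int r) * (pi / m) \<le> pi / 2" using m by (simp add: field_simps)
    show "- (pi / 2) \<le> 2 * of_int (int r) * (pi / m)"
      by (rule order_trans[of _ 0]) auto
  qed
qed (use U in auto)

lemma Re_eigval_le_dirichlet_kernel:
  assumes m: "m > 1" and j: "coprime j m"
    and T: "T \<subseteq> {0..<int m}" "card T \<le> 2 * r + 1" and r: "4 * r \<le> m"
  shows "Re (eigval m T j) \<le> dirichlet_kernel (real (2 * r + 1)) (pi / m)"
proof -
  let ?g = "\<lambda>a. centered_residue m (a * int j)"
  have finite_T: "finite T" using T(1) finite_subset by blast
  have inj: "inj_on ?g T" using inj_on_centered_residue_mult[OF j] T(1) by (rule inj_on_subset)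
  have "cos (2 * of_int (?g a) * (pi / m)) = cos (2 * of_int a * (pi * j / m))" for a
    using cos_char_cong[OF _ cong_centered_residue[of m "a * int j"], of 1] m
    by (simp add: mult_ac)
  then have "Re (eigval m T j) = (\<Sum>a\<in>?g ` T. cos (2 * of_int a * (pi / m)))"
    by (simp add: Re_eigval sum.reindex[OF inj])
  also have "\<dots> \<le> (\<Sum>a = - int r..int r. cos (2 * of_int a * (pi / m)))"
    using m r finite_T T(2) card_image[OF inj]
    by (intro sum_cos_centered_le) (auto simp: abs_centered_residue_le)
  also have "\<dots> = dirichlet_kernel (real (2 * r + 1)) (pi / m)"
    using sin_pi_div_pos[of m] m by (intro sum_cos_eq_dirichlet_kernel) auto
  finally show ?thesis .
qed

lemma Re_eigval_square_le_max:
  assumes m: "m > 1" and j: "coprime j m"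
    and T: "T \<subseteq> {0..<int m}" "0 \<in> T" "card T \<le> 2 * r + 1" and r: "4 * r \<le> m"
  shows "(Re (eigval m T j))\<^sup>2 \<le> max ((dirichlet_kernel (real (2 * r + 1)) (pi / m))\<^sup>2) ((2 * real r - 1)\<^sup>2)"
proof (cases "0 \<le> Re (eigval m T j)")
  case True
  moreover have "Re (eigval m T j) \<le> dirichlet_kernel (real (2 * r + 1)) (pi / m)"
    using m j T(1,3) r by (rule Re_eigval_le_dirichlet_kernel)
  ultimately show ?thesis by (intro max.coboundedI1 power_mono)
next
  case False
  have "2 - real (card T) \<le> Re (eigval m T j)"
    using T(1,2) finite_subset by (intro Re_eigval_ge) auto
  then have "- Re (eigval m T j) \<le> 2 * real r - 1" using T(3) by linarith
  then have "(- Re (eigval m T j))\<^sup>2 \<le> (2 * real r - 1)\<^sup>2"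
    using False by (intro power_mono) auto
  then show ?thesis by (simp add: max.coboundedI2)
qed

section \<open>Cayley subsets\<close>

lemma ramanujan_iff:
  assumes "m \<ge> 2"
  shows "ramanujan m S \<longleftrightarrow> (\<forall>j\<in>{1..m - 1}. (cmod (eigval m S j))\<^sup>2 \<le> 4 * (real (card S) - 1))"
proof -
  have le_sqrt_iff: "x \<le> 2 * sqrt y \<longleftrightarrow> x\<^sup>2 \<le> 4 * y" if "0 \<le> x" for x y :: real
    using that real_sqrt_le_iff[of "x\<^sup>2" "4 * y"] by (simp add: real_sqrt_mult)
  have "ramanujan m S \<longleftrightarrow> (\<forall>j\<in>{1..m - 1}. cmod (eigval m S j) \<le> 2 * sqrt (real (card S) - 1))"
    using assms by (simp add: ramanujan_def max_eigval_def)
  then show ?thesis by (simp add: le_sqrt_iff)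
qed

lemma cayley_subset_iff:
  assumes "m > 0"
  shows "cayley_subset m S \<longleftrightarrow> S \<subseteq> {1..<int m} \<and> (\<forall>a\<in>S. int m - a \<in> S) \<and>
    generate (integer_mod_group m) S = carrier (integer_mod_group m)"
proof -
  let ?G = "integer_mod_group m"
  have carrier: "carrier ?G = {0..<int m}"
    using assms by (simp add: carrier_integer_mod_group)
  have nonzero: "{1..<int m} = carrier ?G - {\<one>\<^bsub>?G\<^esub>}"
    by (auto simp: carrier)
  have "S = set_inv\<^bsub>?G\<^esub> S \<longleftrightarrow> (\<forall>a\<in>S. int m - a \<in> S)" if S: "S \<subseteq> {1..<int m}"
  proof -
    have "inv\<^bsub>?G\<^esub> a = int m - a" if "a \<in> S" for a
    proof -
      have "0 < a" "a < int m" using S that by auto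
      then show ?thesis by (simp add: carrier zmod_zminus1_eq_if)
    qed
    then have "set_inv\<^bsub>?G\<^esub> S = (\<lambda>a. int m - a) ` S" by (auto simp: SET_INV_def)
    moreover have "S \<subseteq> (\<lambda>a. int m - a) ` S" if "\<forall>a\<in>S. int m - a \<in> S"
      using that by (auto intro: image_eqI[of _ _ "int m - _"])
    ultimately show ?thesis by auto
  qed
  then show ?thesis unfolding cayley_subset_def using nonzero by blast
qed

lemma generate_integer_mod_group_prime:
  assumes p: "prime p" and S: "S \<subseteq> carrier (integer_mod_group p)" and a: "a \<in> S" "a \<noteq> 0"
  shows "generate (integer_mod_group p) S = carrier (integer_mod_group p)"
proof -
  let ?G = "integer_mod_group p"
  let ?H = "generate ?G S"
  interpret group ?G by simp
  have carrier: "carrier ?G = {0..<int p}"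
    using prime_gt_0_nat[OF p] by (simp add: carrier_integer_mod_group)
  have subgroup: "subgroup ?H ?G" using S by (rule generate_is_subgroup)
  have incl: "?H \<subseteq> carrier ?G" using subgroup by (rule subgroup.subset)
  have "card ?H dvd order ?G"
    using lagrange[OF subgroup] by (metis dvd_triv_right)
  then have "card ?H dvd p" by (simp add: order_def carrier)
  moreover have "card {0, a} \<le> card ?H"
    using a incl
    by (intro card_mono)
      (auto simp: carrier intro: generate.incl generate.one[of ?G S, simplified] finite_subset)
  then have "card ?H \<noteq> 1" using a(2) by simp
  ultimately have "card ?H = p" using p prime_nat_iff by blast
  then show ?thesis using incl by (intro card_subset_eq) (simp_all add: carrier)
qed

lemma odd_covalency:
  assumes S: "cayley_subset m S" and m: "odd m"
  shows "odd (covalency m S)"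
proof -
  have incl: "S \<subseteq> {1..<int m}" and reflect: "\<And>a. a \<in> S \<Longrightarrow> int m - a \<in> S"
    using S odd_pos[OF m] by (auto simp: cayley_subset_iff)
  have fin: "finite S" using incl finite_subset by blast
  let ?A = "{a \<in> S. 2 * a < int m}" and ?B = "{a \<in> S. int m < 2 * a}"
  have "bij_betw (\<lambda>a. int m - a) ?A ?B"
    by (rule bij_betw_byWitness[where f' = "\<lambda>a. int m - a"]) (auto intro: reflect)
  then have "card ?A = card ?B" by (rule bij_betw_same_card)
  moreover have "2 * a \<noteq> int m" for a using m by presburger
  then have "S = ?A \<union> ?B" using linorder_neqE by blast
  then have "card S = card ?A + card ?B" using fin by (subst card_Un_disjoint[symmetric]) auto
  ultimately have "even (card S)" by simp
  moreover have "card S \<le> card {1..<int m}" using incl by (intro card_mono) auto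
  ultimately show ?thesis using m by (simp add: covalency_def)
qed

definition middle_residues :: "nat \<Rightarrow> nat \<Rightarrow> int set" where
  "middle_residues m r = {int r<..<int m - int r}"

lemma card_middle_residues: "2 * r + 1 \<le> m \<Longrightarrow> card (middle_residues m r) = m - (2 * r + 1)"
  by (simp add: middle_residues_def)

lemma covalency_middle_residues: "2 * r + 1 \<le> m \<Longrightarrow> covalency m (middle_residues m r) = 2 * r + 1"
  by (simp add: covalency_def card_middle_residues)

lemma cayley_subset_middle_residues:
  assumes "prime p" "2 * r + 3 \<le> p"
  shows "cayley_subset p (middle_residues p r)"
proof -
  have "generate (integer_mod_group p) (middle_residues p r) = carrier (integer_mod_group p)"
    using assms
    by (intro generate_integer_mod_group_prime[of _ _ "int r + 1"])
      (auto simp: middle_residues_def carrier_integer_mod_group)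
  then show ?thesis
    using prime_gt_0_nat[OF assms(1)] by (auto simp: cayley_subset_iff middle_residues_def)
qed

lemma Re_eigval_middle_residues:
  assumes "m > 1" "2 * r + 1 \<le> m"
  shows "Re (eigval m (middle_residues m r) 1) = - dirichlet_kernel (real (2 * r + 1)) (pi / m)"
proof -
  have "eigval m (middle_residues m r) 1
      = - eigval m ({- int r..<- int r + int m} - middle_residues m r) 1"
    using assms by (intro eigval_eq_uminus_Compl) (auto simp: middle_residues_def)
  also have "{- int r..<- int r + int m} - middle_residues m r = {- int r..int r}"
    using assms by (auto simp: middle_residues_def)
  finally show ?thesis
    using sum_cos_eq_dirichlet_kernel[of "pi / m" r] sin_pi_div_pos[of m] assms
    by (simp add: Re_eigval)
qed

definition kernel_ramanujan :: "nat \<Rightarrow> nat \<Rightarrow> bool" where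
  "kernel_ramanujan m l \<longleftrightarrow> (dirichlet_kernel (real l) (pi / m))\<^sup>2 \<le> 4 * (real m - real l - 1)"

lemma kernel_ramanujan_if_ramanujan_middle_residues:
  assumes m: "m \<ge> 2" and r: "2 * r + 1 \<le> m" and ram: "ramanujan m (middle_residues m r)"
  shows "kernel_ramanujan m (2 * r + 1)"
proof -
  have "(Re (eigval m (middle_residues m r) 1))\<^sup>2 \<le> (cmod (eigval m (middle_residues m r) 1))\<^sup>2"
    by (simp add: cmod_power2)
  also have "\<dots> \<le> 4 * (real (card (middle_residues m r)) - 1)"
    using ram m by (simp add: ramanujan_iff)
  finally show ?thesis
    using m r
    by (simp add: kernel_ramanujan_def Re_eigval_middle_residues card_middle_residues of_nat_diff del: One_nat_def)
qed

lemma ramanujan_if_covalency_le: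
  assumes p: "prime p" and S: "cayley_subset p S" "covalency p S \<le> 2 * r + 1" and r: "4 * r \<le> p"
    and kernel: "kernel_ramanujan p (2 * r + 1)"
    and lower: "(2 * real r - 1)\<^sup>2 \<le> 4 * (real p - real (2 * r + 1) - 1)"
  shows "ramanujan p S"
proof -
  let ?T = "{0..<int p} - S"
  have p_ge_2: "p \<ge> 2" using p by (rule prime_ge_2_nat)
  have incl: "S \<subseteq> {1..<int p}" and reflect: "\<And>a. a \<in> S \<Longrightarrow> int p - a \<in> S"
    using S(1) p_ge_2 by (auto simp: cayley_subset_iff)
  then have incl_residues: "S \<subseteq> {0..<int p}" by force
  have card_S: "card S \<le> p" using card_mono[OF _ incl_residues] by simp
  have card_T: "card ?T = p - card S"
    using incl_residues by (simp add: card_Diff_subset finite_subset)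
  have card_T_le: "card ?T \<le> 2 * r + 1" using S(2) by (simp only: covalency_def card_T)
  have "(cmod (eigval p S j))\<^sup>2 \<le> 4 * (real (card S) - 1)" if j: "j \<in> {1..p - 1}" for j
  proof -
    have not_dvd: "\<not> p dvd j" using j by (auto dest: dvd_imp_le)
    then have "coprime j p" using p by (metis coprime_commute prime_imp_coprime)
    then have "(Re (eigval p ?T j))\<^sup>2
        \<le> max ((dirichlet_kernel (real (2 * r + 1)) (pi / p))\<^sup>2) ((2 * real r - 1)\<^sup>2)"
      using p_ge_2 incl card_T_le r by (intro Re_eigval_square_le_max) auto
    also have "\<dots> \<le> 4 * (real p - real (2 * r + 1) - 1)"
      using kernel lower by (simp only: kernel_ramanujan_def max.bounded_iff)
    also have "\<dots> \<le> 4 * (real (card S) - 1)"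
      using card_T card_T_le card_S by simp
    finally have "(Re (eigval p ?T j))\<^sup>2 \<le> 4 * (real (card S) - 1)" .
    moreover have "eigval p S j = - eigval p ?T j"
      using eigval_eq_uminus_Compl[of p j S 0] p_ge_2 not_dvd incl_residues by simp
    moreover have "eigval p S j = of_real (Re (eigval p S j))"
      using p_ge_2 reflect by (intro eigval_of_real_if_symmetric) auto
    ultimately show ?thesis by (metis norm_of_real power2_abs power2_minus uminus_complex.sel(1))
  qed
  then show ?thesis using p_ge_2 by (simp add: ramanujan_iff)
qed

lemma l_hat_eqI:
  assumes p: "prime p" "odd p" and r: "4 * r \<le> p" "2 * r + 5 \<le> p"
    and kernel: "kernel_ramanujan p (2 * r + 1)" "\<not> kernel_ramanujan p (2 * r + 3)"
    and lower: "(2 * real r - 1)\<^sup>2 \<le> 4 * (real p - real (2 * r + 1) - 1)"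
  shows "l_hat p = 2 * r + 1"
  unfolding l_hat_def
proof (rule Max_eqI[OF finite_good_covalencies])
  have "ramanujan p S" if "cayley_subset p S" "covalency p S \<le> 2 * r + 1" for S
    using p(1) that r(1) kernel(1) lower by (rule ramanujan_if_covalency_le)
  moreover have "2 * r + 1 \<in> covalency p ` {S. cayley_subset p S}"
    using p(1) r(2) cayley_subset_middle_residues covalency_middle_residues
    by (intro image_eqI[of _ _ "middle_residues p r"]) simp_all
  ultimately show "2 * r + 1 \<in> good_covalencies p" by (auto simp: good_covalencies_def)
next
  fix l assume "l \<in> good_covalencies p"
  then obtain S where S: "cayley_subset p S" "l = covalency p S"
    and all_ramanujan: "\<And>S. cayley_subset p S \<Longrightarrow> covalency p S \<le> l \<Longrightarrow> ramanujan p S"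
    by (auto simp: good_covalencies_def)
  have "\<not> ramanujan p (middle_residues p (Suc r))"
    using kernel_ramanujan_if_ramanujan_middle_residues[of p "Suc r"] kernel(2) r(2)
    by (auto simp: numeral_3_eq_3)
  then have "l < 2 * r + 3"
    using all_ramanujan[OF cayley_subset_middle_residues[of p "Suc r"]] covalency_middle_residues[of "Suc r" p] p(1) r(2)
    by fastforce
  moreover have "odd l" using odd_covalency[OF S(1) p(2)] S(2) by simp
  ultimately show "l \<le> 2 * r + 1" by presburger
qed

section \<open>Primes of the form \<open>k\<^sup>2 + 5k + c\<close>\<close>

lemma l_zero_eqI:
  assumes "(2 * k + 3)\<^sup>2 \<le> 4 * m" "4 * m < (2 * k + 5)\<^sup>2"
  shows "l_zero m = 2 * int k + 1"
proof -
  have "real ((2 * k + 3)\<^sup>2) \<le> real (4 * m)" "real (4 * m) < real ((2 * k + 5)\<^sup>2)"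
    using assms by (simp_all only: of_nat_le_iff of_nat_less_iff)
  then have "(real k + 3 / 2)\<^sup>2 \<le> real m" "real m < (real k + 5 / 2)\<^sup>2"
    by (simp_all add: power2_eq_square field_simps)
  then have "real k + 3 / 2 \<le> sqrt (real m)" "sqrt (real m) < real k + 5 / 2"
    by (auto intro: real_le_rsqrt real_less_lsqrt)
  then have "\<lfloor>sqrt (real m) - 3 / 2\<rfloor> = int k" by (simp add: floor_eq_iff)
  then show ?thesis by (simp add: l_zero_def)
qed

lemma four_mult_eq_square_diff:
  fixes m k :: nat and c :: int
  assumes "int m = (int k)\<^sup>2 + 5 * int k + c"
  shows "4 * real m = (2 * real k + 5)\<^sup>2 - (25 - 4 * of_int c)"
  using arg_cong[OF assms, of real_of_int] by (simp add: power2_eq_square algebra_simps)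

lemma exceptionalI:
  fixes p k :: nat and c :: int
  assumes p: "prime p" "odd p" and pc: "int p = (int k)\<^sup>2 + 5 * int k + c"
    and k: "2 \<le> k" "17 \<le> 8 * int k + 4 * c" "c \<le> 5"
    and kernel: "kernel_ramanujan p (2 * k + 3)" "\<not> kernel_ramanujan p (2 * k + 5)"
  shows "exceptional p"
proof -
  have k_square: "2 * int k \<le> (int k)\<^sup>2" using k(1) by (simp add: power2_eq_square)
  then have p_ge: "4 * int k + 4 \<le> int p" "2 * int k + 7 \<le> int p" "15 \<le> int p"
    using pc k by linarith+
  have real_k: "17 \<le> 8 * real k + 4 * of_int c" using k(2) by linarith
  have "l_hat p = 2 * (k + 1) + 1"
  proof (rule l_hat_eqI[OF p])
    show "4 * (k + 1) \<le> p" "2 * (k + 1) + 5 \<le> p" using p_ge by auto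
    have "4 * (real p - real (2 * (k + 1) + 1) - 1) = (2 * real k + 3)\<^sup>2 - (25 - 4 * of_int c)"
      using four_mult_eq_square_diff[OF pc] by (simp add: power2_eq_square algebra_simps)
    then show "(2 * real (k + 1) - 1)\<^sup>2 \<le> 4 * (real p - real (2 * (k + 1) + 1) - 1)"
      using real_k by (simp add: power2_eq_square algebra_simps)
    show "kernel_ramanujan p (2 * (k + 1) + 1)" "\<not> kernel_ramanujan p (2 * (k + 1) + 3)"
      using kernel by (simp_all add: numeral_eq_Suc)
  qed
  moreover have "int ((2 * k + 3)\<^sup>2) \<le> int (4 * p)" "int (4 * p) < int ((2 * k + 5)\<^sup>2)"
    using k by (simp_all add: pc power2_eq_square algebra_simps)
  then have "l_zero p = 2 * int k + 1"
    by (intro l_zero_eqI) (simp_all only: of_nat_le_iff of_nat_less_iff)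
  ultimately show ?thesis using p(2) p_ge by (simp add: exceptional_def)
qed

lemma shifted_square_cross_mult_le:
  fixes l l0 d :: real
  assumes "0 \<le> l0" "l0 \<le> l" "4 \<le> d"
  shows "l * ((l0 + 2)\<^sup>2 - d) \<le> l0 * ((l + 2)\<^sup>2 - d)"
proof -
  have "0 \<le> l * l0" using assms by simp
  then have "0 \<le> (l - l0) * (l * l0 + (d - 4))" using assms by (intro mult_nonneg_nonneg) linarith+
  then show ?thesis by (simp add: power2_eq_square algebra_simps)
qed

text \<open>The quotient \<open>((l + 2)\<^sup>2 - d) / l\<^sup>2 = 1 + 4/l - (d - 4)/l\<^sup>2\<close> is quadratic in \<open>1/l\<close>, with vertex at
  \<open>l = (d - 4)/2\<close>.\<close>

lemma shifted_square_le_vertex: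
  fixes l d :: real
  assumes "4 < d"
  shows "(l + 2)\<^sup>2 - d \<le> d / (d - 4) * l\<^sup>2"
proof -
  have "(d - 4) * ((l + 2)\<^sup>2 - d) = d * l\<^sup>2 - (2 * l - (d - 4))\<^sup>2"
    by (simp add: power2_eq_square algebra_simps)
  then have "(d - 4) * ((l + 2)\<^sup>2 - d) \<le> d * l\<^sup>2" by simp
  then show ?thesis using assms by (simp add: pos_le_divide_eq mult.commute)
qed

lemma shifted_square_le_beyond_vertex:
  fixes l l0 d :: real
  assumes "0 < l0" "l0 \<le> l" "d - 4 \<le> 2 * l0"
  shows "(l + 2)\<^sup>2 - d \<le> ((l0 + 2)\<^sup>2 - d) / l0\<^sup>2 * l\<^sup>2"
proof -
  have "(d - 4) * (l + l0) \<le> 2 * l0 * (l + l0)"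
    using assms by (intro mult_right_mono) auto
  also have "\<dots> \<le> 4 * l * l0"
    using assms by (simp add: algebra_simps)
  finally have "0 \<le> (l - l0) * (4 * l * l0 - (d - 4) * (l + l0))"
    using assms(2) by simp
  then have "((l + 2)\<^sup>2 - d) * l0\<^sup>2 \<le> ((l0 + 2)\<^sup>2 - d) * l\<^sup>2"
    by (simp add: power2_eq_square algebra_simps)
  then show ?thesis using assms(1) by (simp add: pos_le_divide_eq)
qed

text \<open>The criterion \<open>dirichlet_kernel_square_le\<close> at \<open>x = \<pi>/m\<close> reads
  \<open>d \<le> (l\<^sup>2/m)\<^sup>2 (\<pi>\<^sup>2 (1 - 1/l\<^sup>2) / 3 - 2\<pi>\<^sup>4 (l/m)\<^sup>2 / 45)\<close>, where \<open>l\<^sup>2/m \<ge> 4/q\<close> and the second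
  factor increases with \<open>l\<close>.\<close>

lemma dirichlet_kernel_square_le_from_start:
  fixes l l0 m m0 d q :: real
  assumes m: "4 * m = (l + 2)\<^sup>2 - d" and m0: "4 * m0 = (l0 + 2)\<^sup>2 - d" "0 < m0"
    and l: "1 \<le> l0" "l0 \<le> l" and d: "4 \<le> d" "d \<le> l0\<^sup>2" and q: "0 < q" "4 * m \<le> q * l\<^sup>2"
    and start: "d \<le> (4 / q)\<^sup>2 * (3.2896 * (1 - 1 / l0\<^sup>2) - 4.33 * (l0 / m0)\<^sup>2)"
  shows "(dirichlet_kernel l (pi / m))\<^sup>2 \<le> l\<^sup>2 - d"
proof (rule dirichlet_kernel_square_le)
  have l_pos: "0 < l" using l by simp
  have l_square: "l0\<^sup>2 \<le> l\<^sup>2" using l by (intro power_mono) auto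
  show "0 \<le> d" "d \<le> l\<^sup>2" using d l_square by linarith+
  have "(l0 + 2)\<^sup>2 \<le> (l + 2)\<^sup>2" using l by (intro power_mono) auto
  then have m_pos: "0 < m" using m m0 by linarith
  have "l * (4 * m0) \<le> l0 * (4 * m)"
    unfolding m m0(1) using l d(1) by (intro shifted_square_cross_mult_le) auto
  then have "l / m \<le> l0 / m0" using m_pos m0(2) by (simp add: field_simps)
  then have "(l / m)\<^sup>2 \<le> (l0 / m0)\<^sup>2" using l_pos m_pos by (intro power_mono) auto
  moreover have "pi ^ 4 \<le> 9.87\<^sup>2" using power_mono[of "pi\<^sup>2" "9.87" 2] pi_square_bounds by simp
  ultimately have tail: "2 * pi ^ 4 / 45 * (l / m)\<^sup>2 \<le> 4.33 * (l0 / m0)\<^sup>2"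
    by (intro mult_mono) (auto simp: power2_eq_square)
  have "1 / l\<^sup>2 \<le> 1 / l0\<^sup>2" "1 / l0\<^sup>2 \<le> 1"
    using l l_square by (auto intro!: frac_le simp: divide_le_eq)
  then have leading: "3.2896 * (1 - 1 / l0\<^sup>2) \<le> pi\<^sup>2 / 3 * (1 - 1 / l\<^sup>2)"
    using pi_square_bounds by (intro mult_mono) auto
  have "0 < (4 / q)\<^sup>2 * (3.2896 * (1 - 1 / l0\<^sup>2) - 4.33 * (l0 / m0)\<^sup>2)"
    using start d(1) by linarith
  then have start_nonneg: "0 \<le> 3.2896 * (1 - 1 / l0\<^sup>2) - 4.33 * (l0 / m0)\<^sup>2"
    using q(1) by (simp add: zero_less_mult_iff)
  have "4 / q \<le> l\<^sup>2 / m" using q m_pos by (simp add: field_simps)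
  then have "(4 / q)\<^sup>2 \<le> (l\<^sup>2 / m)\<^sup>2" using q(1) by (intro power_mono) auto
  with start have "d \<le> (l\<^sup>2 / m)\<^sup>2 * (pi\<^sup>2 / 3 * (1 - 1 / l\<^sup>2) - 2 * pi ^ 4 / 45 * (l / m)\<^sup>2)"
    using start_nonneg by (elim order_trans, intro mult_mono diff_mono leading tail) auto
  also have "\<dots> = (pi / m)\<^sup>2 * l\<^sup>2 * (l\<^sup>2 - 1) / 3 - 2 * (pi / m) ^ 4 * l ^ 6 / 45"
    using l_pos m_pos by (simp add: field_simps eval_nat_numeral)
  finally show "d \<le> (pi / m)\<^sup>2 * l\<^sup>2 * (l\<^sup>2 - 1) / 3 - 2 * (pi / m) ^ 4 * l ^ 6 / 45" .
qed

definition exceptional_pair :: "nat \<Rightarrow> int \<Rightarrow> bool" where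
  "exceptional_pair k c \<longleftrightarrow> c = 5 \<and> 2 \<le> k \<or> c = 3 \<and> 2 \<le> k \<or> c = 1 \<and> 4 \<le> k \<or> c = - 1 \<and> 3 \<le> k \<or>
    c = - 3 \<and> 5 \<le> k \<or> c = - 5 \<and> 19 \<le> k"

lemma kernel_ramanujan_exceptional_pair:
  assumes m: "int m = (int k)\<^sup>2 + 5 * int k + c" and pair: "exceptional_pair k c"
  shows "kernel_ramanujan m (2 * k + 3)"
proof -
  define l d where "l = 2 * real k + 3" and "d = 25 - 4 * real_of_int c"
  have four_m: "4 * real m = (l + 2)\<^sup>2 - d"
    using four_mult_eq_square_diff[OF m] by (simp add: l_def d_def add.assoc)
  note start = dirichlet_kernel_square_le_from_start[OF four_m]
  from pair consider "c = 5" "7 \<le> l" | "c = 3" "7 \<le> l" | "c = 1" "11 \<le> l" | "c = - 1" "9 \<le> l"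
    | "c = - 3" "13 \<le> l" | "c = - 5" "41 \<le> l"
    by (auto simp: exceptional_pair_def l_def)
  then have "(dirichlet_kernel l (pi / m))\<^sup>2 \<le> l\<^sup>2 - d"
  proof cases
    case 1
    then show ?thesis using shifted_square_le_beyond_vertex[of 7 l d] four_m
      by (intro start[of 19 7 "76 / 49"]) (simp_all add: d_def power2_eq_square)
  next
    case 2
    then show ?thesis using shifted_square_le_vertex[of d l] four_m
      by (intro start[of 17 7 "13 / 9"]) (simp_all add: d_def power2_eq_square)
  next
    case 3
    then show ?thesis using shifted_square_le_vertex[of d l] four_m
      by (intro start[of 37 11 "21 / 17"]) (simp_all add: d_def power2_eq_square)
  next
    case 4
    then show ?thesis using shifted_square_le_vertex[of d l] four_m
      by (intro start[of 23 9 "29 / 25"]) (simp_all add: d_def power2_eq_square)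
  next
    case 5
    then show ?thesis using shifted_square_le_vertex[of d l] four_m
      by (intro start[of 47 13 "37 / 33"]) (simp_all add: d_def power2_eq_square)
  next
    case 6
    then show ?thesis using shifted_square_le_beyond_vertex[of 41 l d] four_m
      by (intro start[of 451 41 "44 / 41"]) (simp_all add: d_def power2_eq_square)
  qed
  moreover have "l\<^sup>2 - d = 4 * (real m - l - 1)"
    using four_m by (simp add: power2_eq_square algebra_simps)
  ultimately show ?thesis by (simp add: kernel_ramanujan_def l_def add.commute)
qed

lemma dirichlet_kernel_square_gt_large:
  fixes l m d :: real
  assumes m: "4 * m = l\<^sup>2 - d" "33 \<le> m" and l: "13 \<le> l" and d: "0 \<le> d" "d \<le> 45"
  shows "4 * (m - l - 1) < (dirichlet_kernel l (pi / m))\<^sup>2"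
proof (rule dirichlet_kernel_square_gt)
  have m_pos: "0 < m" using m(2) by simp
  show "sin (pi / m) \<noteq> 0" using sin_pi_div_pos[of m] m(2) by simp
  have "13 * l \<le> l\<^sup>2" using l by (simp add: power2_eq_square)
  then show "0 \<le> 4 * (m - l - 1)" unfolding right_diff_distrib m(1) using l d by simp
  have "d * 33 \<le> d * m" using m(2) d by (intro mult_left_mono) auto
  then have "l\<^sup>2 / m \<le> 4 + d / 33" using m m_pos by (simp add: field_simps)
  then have "(l\<^sup>2 / m)\<^sup>2 \<le> (4 + d / 33)\<^sup>2" using m_pos by (intro power_mono) auto
  then have "pi\<^sup>2 * (l\<^sup>2 / m)\<^sup>2 \<le> 9.87 * (4 + d / 33)\<^sup>2"
    using pi_square_bounds by (intro mult_mono) auto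
  also have "\<dots> < 3 * (56 + d)"
  proof -
    have "d * d \<le> 45 * d" using d by (intro mult_right_mono) auto
    then show ?thesis using d by (simp add: power2_eq_square field_simps)
  qed
  finally have "pi\<^sup>2 * (l\<^sup>2 / m)\<^sup>2 / 3 < 4 * l + 4 + d" using l by simp
  moreover have "pi\<^sup>2 * (l\<^sup>2 / m)\<^sup>2 / 3 = (pi / m)\<^sup>2 * l ^ 4 / 3"
    by (simp add: power_divide flip: power_mult)
  ultimately show "4 * (m - l - 1) < l\<^sup>2 - (pi / m)\<^sup>2 * l ^ 4 / 3"
    using m(1) by simp
qed

text \<open>For \<open>k \<le> 3\<close> the lower Taylor bound of \<open>sin\<^sup>2\<close> is too weak, but \<open>l\<pi>/m\<close> is close to \<open>\<pi>/2\<close>.\<close>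

lemma dirichlet_kernel_pi_div_square_gt_near_pi_half:
  fixes l m R :: real
  assumes m: "1 < m" and R: "0 \<le> R" "9.87 * (4 * R + (m - 2 * l)\<^sup>2) < 4 * m\<^sup>2"
  shows "R < (dirichlet_kernel l (pi / m))\<^sup>2"
proof (rule dirichlet_kernel_square_gt_near_pi_half[OF _ R(1)])
  show "sin (pi / m) \<noteq> 0" using sin_pi_div_pos[OF m] by simp
  have "pi\<^sup>2 * (4 * R + (m - 2 * l)\<^sup>2) \<le> 9.87 * (4 * R + (m - 2 * l)\<^sup>2)"
    using pi_square_bounds R(1) by (intro mult_right_mono) auto
  with R(2) have "pi\<^sup>2 * (4 * R + (m - 2 * l)\<^sup>2) / (4 * m\<^sup>2) < 1" using m by simp
  also have "pi\<^sup>2 * (4 * R + (m - 2 * l)\<^sup>2) / (4 * m\<^sup>2) = R * (pi / m)\<^sup>2 + (pi / 2 - l * (pi / m))\<^sup>2"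
    using m by (simp add: field_simps power2_eq_square)
  finally show "R * (pi / m)\<^sup>2 + (pi / 2 - l * (pi / m))\<^sup>2 < 1" .
qed

lemma not_kernel_ramanujan_exceptional_pair:
  assumes m: "int m = (int k)\<^sup>2 + 5 * int k + c" and pair: "exceptional_pair k c"
  shows "\<not> kernel_ramanujan m (2 * k + 5)"
proof -
  have real_m: "real m = (real k)\<^sup>2 + 5 * real k + of_int c"
    using arg_cong[OF m, of real_of_int] by simp
  have "4 * (real m - (2 * real k + 5) - 1) < (dirichlet_kernel (2 * real k + 5) (pi / m))\<^sup>2"
  proof (cases "4 \<le> k")
    case True
    have "4\<^sup>2 + 5 * 4 \<le> (real k)\<^sup>2 + 5 * real k" using True by (intro add_mono power_mono) auto
    moreover have "5\<^sup>2 + 5 * 5 \<le> (real k)\<^sup>2 + 5 * real k" if "5 \<le> k"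
      using that by (intro add_mono power_mono) auto
    ultimately have "33 \<le> real m" using pair True by (auto simp: real_m exceptional_pair_def)
    moreover have "- 5 \<le> c" "c \<le> 5" using pair by (auto simp: exceptional_pair_def)
    ultimately show ?thesis
      using True four_mult_eq_square_diff[OF m]
      by (intro dirichlet_kernel_square_gt_large[of _ _ "25 - 4 * of_int c"]) auto
  next
    case False
    then consider "k = 2" "c = 5" | "k = 2" "c = 3" | "k = 3" "c = 5" | "k = 3" "c = 3" | "k = 3" "c = - 1"
      using pair by (force simp: exceptional_pair_def)
    then show ?thesis
      by cases (rule dirichlet_kernel_pi_div_square_gt_near_pi_half; simp add: real_m power2_eq_square)+
  qed
  then show ?thesis by (simp add: kernel_ramanujan_def add.commute)
qed

lemma prime_in_J_exceptional_pair:
  assumes "prime p" "p \<in> J"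
  obtains k c where "int p = (int k)\<^sup>2 + 5 * int k + c" "exceptional_pair k c"
proof -
  from assms(2) consider (small) n where "p = 2 * n + 1" "7 \<le> n" "n \<le> 14"
    | (main) k c where "4 \<le> k" "c \<in> {1, - 1, 3, - 3, 5}" "int p = (int k)\<^sup>2 + 5 * int k + c"
    | (minus_five) k where "19 \<le> k" "int p = (int k)\<^sup>2 + 5 * int k - 5"
    by (auto simp: J_def)
  then show thesis
  proof cases
    case small
    then have "n \<in> {7, 8, 9, 10, 11, 12, 13, 14}" by auto
    then have "p \<in> {15, 17, 19, 21, 23, 25, 27, 29}" using small by auto
    moreover have "p \<noteq> 15" "p \<noteq> 21" "p \<noteq> 25" "p \<noteq> 27" using assms(1) by auto
    ultimately consider "p = 17" | "p = 19" | "p = 23" | "p = 29" by blast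
    then show thesis
      by cases (use that[of 2 3] that[of 2 5] that[of 3 "- 1"] that[of 3 5] in
        \<open>simp_all add: exceptional_pair_def\<close>)
  next
    case main
    have "p \<noteq> 33" using assms(1) by auto
    then have "\<not> (k = 4 \<and> c = - 3)" using main(3) by auto
    then have "exceptional_pair k c" using main(1,2) by (auto simp: exceptional_pair_def)
    then show thesis using main(3) that by blast
  next
    case (minus_five k)
    then show thesis using that[of k "- 5"] by (simp add: exceptional_pair_def)
  qed
qed

theorem theorem4p3:
  fixes p :: nat
  assumes "prime p" and "odd p" and "p \<in> J"
  shows "exceptional p"
proof -
  obtain k c where p: "int p = (int k)\<^sup>2 + 5 * int k + c" and pair: "exceptional_pair k c"
    using prime_in_J_exceptional_pair[OF assms(1,3)] by blast
  show ?thesis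
  proof (rule exceptionalI[OF assms(1,2) p])
    show "2 \<le> k" "17 \<le> 8 * int k + 4 * c" "c \<le> 5"
      using pair by (auto simp: exceptional_pair_def)
    show "kernel_ramanujan p (2 * k + 3)" "\<not> kernel_ramanujan p (2 * k + 5)"
      using p pair kernel_ramanujan_exceptional_pair not_kernel_ramanujan_exceptional_pair by blast+
  qed
qed

end
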